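(* Let $\Lambda\subset\mathbb{E}^n$ be a lattice and suppose that its orthogonal group $\mathrm{O}_\Lambda:=\{\varphi\in\mathrm{O}(n) : \varphi(\Lambda)=\Lambda\}$ acts irreducibly on $\mathbb{E}^n$. Then $\Theta_{1,1;\Lambda}$ is zero.
   Context: $\mathbb{E}^n$ is Euclidean $n$-space (a real vector space; irreducible means irreducible as a real representation), and lattices in $\mathbb{E}^n$ have rank $n$. For a lattice $\Lambda\subset\mathbb{E}^n$ the holomorphic function $\Theta_{1,1;\Lambda}$ on the upper half plane is $$\Theta_{1,1;\Lambda}(z)=\sum_{(\gamma,\delta)\in\Lambda\times\Lambda}\left(\frac12\langle\gamma,\delta\rangle^2-\frac1{2n}\|\gamma\|^2\|\delta\|^2\right)\exp\bigl(2\pi i(\|\gamma\|^2+\|\delta\|^2)z\bigr).$$ *)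

theory Defs
  imports "HOL-Analysis.Analysis"
begin

definition is_lattice :: "(real^'n) set \<Rightarrow> bool" where
  "is_lattice L \<longleftrightarrow>
     (\<exists>B. independent B \<and> span B = UNIV \<and>
          L = {\<Sum>b\<in>B. of_int (k b) *\<^sub>R b | k :: real^'n \<Rightarrow> int. True})"

definition orthogonal_group_of :: "(real^'n) set \<Rightarrow> (real^'n \<Rightarrow> real^'n) set" where
  "orthogonal_group_of L = {\<phi>. orthogonal_transformation \<phi> \<and> \<phi> ` L = L}"

definition acts_irreducibly :: "('a::real_vector \<Rightarrow> 'a) set \<Rightarrow> bool" where
  "acts_irreducibly G \<longleftrightarrow>
     (UNIV :: 'a set) \<noteq> {0} \<and>
     (\<forall>W. subspace W \<and> (\<forall>g\<in>G. g ` W \<subseteq> W) \<longrightarrow> W = {0} \<or> W = UNIV)"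

definition theta11_term :: "complex \<Rightarrow> real^'n \<Rightarrow> real^'n \<Rightarrow> complex" where
  "theta11_term z \<gamma> \<delta> =
     of_real (1/2 * (\<gamma> \<bullet> \<delta>)\<^sup>2 - 1 / (2 * real CARD('n)) * (norm \<gamma>)\<^sup>2 * (norm \<delta>)\<^sup>2)
     * exp (2 * of_real pi * \<i> * of_real ((norm \<gamma>)\<^sup>2 + (norm \<delta>)\<^sup>2) * z)"

text \<open>
  Only meaningful for \<open>Im z > 0\<close>. Since \<^const>\<open>infsum\<close> returns \<open>0\<close> on families that are not
  summable, lemma \<open>theta11_abs_summable\<close> below shows that for a lattice and \<open>Im z > 0\<close> the
  series converges absolutely.
\<close>

definition theta11 :: "(real^'n) set \<Rightarrow> complex \<Rightarrow> complex" where
  "theta11 L z = (\<Sum>\<^sub>\<infinity>(\<gamma>, \<delta>)\<in>L \<times> L. theta11_term z \<gamma> \<delta>)"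

lemma summable_on_exp_neg_abs_int: "(\<lambda>j::int. exp (- \<bar>real_of_int j\<bar>)) summable_on UNIV"
proof -
  have "summable (\<lambda>n. exp (-1::real) ^ n)"
    by (intro summable_geometric) auto
  then have "summable (\<lambda>n::nat. norm (exp (- real n)))"
    by (simp add: exp_of_nat_mult[symmetric])
  then have s: "(\<lambda>n::nat. exp (- real n)) summable_on UNIV"
    by (rule norm_summable_imp_summable_on)
  have "(\<lambda>j::int. exp (- \<bar>real_of_int j\<bar>)) summable_on range int"
    using s by (subst summable_on_reindex) (auto simp: o_def)
  moreover have "(\<lambda>j::int. exp (- \<bar>real_of_int j\<bar>)) summable_on range (\<lambda>n. - int (Suc n))"
  proof -
    have "(\<lambda>n::nat. exp (-1) * exp (- real n)) summable_on UNIV"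
      by (rule summable_on_cmult_right[OF s])
    then show ?thesis
      by (subst summable_on_reindex) (auto simp: o_def inj_def exp_add[symmetric] algebra_simps)
  qed
  moreover have "range int \<inter> range (\<lambda>n. - int (Suc n)) = {}"
    by auto
  moreover have "range int \<union> range (\<lambda>n. - int (Suc n)) = UNIV"
  proof -
    have "j \<in> range int \<union> range (\<lambda>n. - int (Suc n))" for j :: int
      by (cases j) auto
    then show ?thesis by blast
  qed
  ultimately show ?thesis
    using summable_on_Un_disjoint by metis
qed

lemma lattice_gaussian_summable:
  fixes L :: "(real^'n) set"
  assumes L: "is_lattice L" and a: "a > 0"
  shows "(\<lambda>v. (norm v)\<^sup>2 * exp (- a * (norm v)\<^sup>2)) summable_on L"
proof -
  from L obtain B where B: "independent B" "span B = UNIV"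
    and LB: "L = {\<Sum>b\<in>B. of_int (k b) *\<^sub>R b | k :: real^'n \<Rightarrow> int. True}"
    unfolding is_lattice_def by blast
  have fin: "finite B" using B(1) by (rule independent_imp_finite)
  define h where "h k = (\<Sum>b\<in>B. of_int (k b) *\<^sub>R b)" for k :: "real^'n \<Rightarrow> int"
  define P where "P = PiE B (\<lambda>_. UNIV :: int set)"
  have Lh: "L = h ` P"
  proof (rule set_eqI)
    fix v
    have "\<exists>k'\<in>P. v = h k'" if "v = h k" for k
      using that unfolding h_def P_def
      by (intro bexI[of _ "restrict k B"]) (auto intro!: sum.cong)
    then show "v \<in> L \<longleftrightarrow> v \<in> h ` P"
      unfolding LB h_def[symmetric] by auto
  qed
  have rep: "representation B (h k) b = of_int (k b)" if "b \<in> B" for k b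
  proof -
    have "representation B (\<Sum>b\<in>B. of_int (k b) *\<^sub>R b) = (\<lambda>b. if b \<in> B then of_int (k b) else 0)"
    proof (rule representation_eqI[OF B(1)])
      show "finite {b. (if b \<in> B then real_of_int (k b) else 0) \<noteq> 0}"
        by (rule finite_subset[OF _ fin]) (auto split: if_splits)
      show "(\<Sum>b | (if b \<in> B then real_of_int (k b) else 0) \<noteq> 0.
               (if b \<in> B then real_of_int (k b) else 0) *\<^sub>R b) = (\<Sum>b\<in>B. real_of_int (k b) *\<^sub>R b)"
        by (rule sum.mono_neutral_cong_left[OF fin]) (auto split: if_splits)
    qed (use B in \<open>auto split: if_splits\<close>)
    then show ?thesis using that by (simp add: h_def)
  qed
  have inj: "inj_on h P"
  proof (rule inj_onI)
    fix k k' assume k: "k \<in> P" "k' \<in> P" "h k = h k'"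
    show "k = k'"
    proof (rule PiE_ext[of k B "\<lambda>_. UNIV" k'])
      fix b assume "b \<in> B"
      then have "real_of_int (k b) = of_int (k' b)" using rep k(3) by metis
      then show "k b = k' b" by simp
    qed (use k in \<open>auto simp: P_def\<close>)
  qed
  define C where "C b = (SOME C. \<forall>v. \<bar>representation B v b\<bar> \<le> C * norm v)" for b
  have C: "\<bar>representation B v b\<bar> \<le> C b * norm v" for v b
  proof -
    have "linear (\<lambda>v. representation B v b)"
      by (rule linearI) (use B in \<open>auto simp: representation_add representation_scale\<close>)
    then obtain K where "\<forall>v. norm (representation B v b) \<le> K * norm v"
      using linear_bounded by blast
    then have "\<forall>v. \<bar>representation B v b\<bar> \<le> C b * norm v"
      unfolding C_def by (intro someI_ex[where P="\<lambda>C. \<forall>v. \<bar>representation B v b\<bar> \<le> C * norm v"]) auto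
    then show ?thesis by blast
  qed
  define D where "D = (\<Sum>b\<in>B. C b)"
  have D: "(\<Sum>b\<in>B. \<bar>real_of_int (k b)\<bar>) \<le> D * norm (h k)" for k
  proof -
    have "(\<Sum>b\<in>B. \<bar>real_of_int (k b)\<bar>) \<le> (\<Sum>b\<in>B. C b * norm (h k))"
      by (rule sum_mono) (use rep C in metis)
    then show ?thesis by (simp add: D_def sum_distrib_right)
  qed
  define M where "M = 2 * exp ((1 + D)\<^sup>2 / (4 * a))"
  have bound: "(norm (h k))\<^sup>2 * exp (- a * (norm (h k))\<^sup>2)
                 \<le> M * (\<Prod>b\<in>B. exp (- \<bar>real_of_int (k b)\<bar>))" for k
  proof -
    define t where "t = norm (h k)"
    have "t \<ge> 0" by (simp add: t_def)
    then have "t\<^sup>2 \<le> 2 * exp t"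
      using exp_lower_Taylor_quadratic[of t] by (simp add: field_simps)
    then have "t\<^sup>2 * exp (- a * t\<^sup>2) \<le> 2 * exp t * exp (- a * t\<^sup>2)"
      by (intro mult_right_mono) auto
    also have "\<dots> = 2 * exp (t - a * t\<^sup>2)" by (simp add: exp_add[symmetric])
    also have "t - a * t\<^sup>2 \<le> (1 + D)\<^sup>2 / (4 * a) - D * t"
    proof -
      have "0 \<le> (1 + D - 2 * a * t)\<^sup>2 / (4 * a)" using a by simp
      also have "\<dots> = (1 + D)\<^sup>2 / (4 * a) - (1 + D) * t + a * t\<^sup>2"
        using a by (simp add: field_simps power2_eq_square)
      finally show ?thesis by (simp add: algebra_simps)
    qed
    then have "2 * exp (t - a * t\<^sup>2) \<le> 2 * exp ((1 + D)\<^sup>2 / (4 * a) - D * t)" by simp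
    also have "\<dots> = M * exp (- (D * t))" by (simp add: M_def exp_diff exp_minus field_simps)
    also have "\<dots> \<le> M * exp (- (\<Sum>b\<in>B. \<bar>real_of_int (k b)\<bar>))"
      using D[of k] by (intro mult_left_mono) (auto simp: M_def t_def)
    also have "\<dots> = M * (\<Prod>b\<in>B. exp (- \<bar>real_of_int (k b)\<bar>))"
      using fin by (simp add: exp_sum[symmetric] sum_negf)
    finally show ?thesis by (simp add: t_def)
  qed
  have "Infinite_Set_Sum.abs_summable_on (\<lambda>k. \<Prod>b\<in>B. exp (- \<bar>real_of_int (k b)\<bar>)) P"
    unfolding P_def
  proof (rule abs_summable_on_prod_PiE[OF fin])
    have "(\<lambda>j::int. norm (exp (- \<bar>real_of_int j\<bar>))) summable_on UNIV"
      using summable_on_exp_neg_abs_int by simp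
    then show "Infinite_Set_Sum.abs_summable_on (\<lambda>j::int. exp (- \<bar>real_of_int j\<bar>)) UNIV"
      by (simp only: abs_summable_equivalent)
  qed auto
  then have "(\<lambda>k. norm (\<Prod>b\<in>B. exp (- \<bar>real_of_int (k b)\<bar>))) summable_on P"
    by (simp only: abs_summable_equivalent)
  then have "(\<lambda>k. M * (\<Prod>b\<in>B. exp (- \<bar>real_of_int (k b)\<bar>))) summable_on P"
    by (intro summable_on_cmult_right) (simp add: abs_prod)
  then have "(\<lambda>k. (norm (h k))\<^sup>2 * exp (- a * (norm (h k))\<^sup>2)) summable_on P"
    by (rule summable_on_comparison_test) (use bound in auto)
  then show ?thesis
    unfolding Lh by (subst summable_on_reindex[OF inj]) (simp add: o_def)
qed

lemma norm_theta11_term_le: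
  fixes \<gamma> \<delta> :: "real^'n"
  shows "norm (theta11_term z \<gamma> \<delta>) \<le>
    ((norm \<gamma>)\<^sup>2 * exp (- (2 * pi * Im z) * (norm \<gamma>)\<^sup>2)) *
    ((norm \<delta>)\<^sup>2 * exp (- (2 * pi * Im z) * (norm \<delta>)\<^sup>2))"
proof -
  define q where "q = (norm \<gamma>)\<^sup>2 * (norm \<delta>)\<^sup>2"
  have q: "q \<ge> 0" by (simp add: q_def)
  have ip: "(\<gamma> \<bullet> \<delta>)\<^sup>2 \<le> q"
    using Cauchy_Schwarz_ineq[of \<gamma> \<delta>] by (simp add: q_def power2_norm_eq_inner)
  have n: "1 / (2 * real CARD('n)) * q \<le> 1/2 * q" "0 \<le> 1 / (2 * real CARD('n)) * q"
    using q by (intro mult_right_mono, simp_all add: field_simps Suc_leI)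
  have "\<bar>1/2 * (\<gamma> \<bullet> \<delta>)\<^sup>2 - 1 / (2 * real CARD('n)) * q\<bar> \<le> q"
    using ip n q zero_le_power2[of "\<gamma> \<bullet> \<delta>"] by linarith
  then have "norm (theta11_term z \<gamma> \<delta>) \<le>
      q * exp (- (2 * pi * ((norm \<gamma>)\<^sup>2 + (norm \<delta>)\<^sup>2) * Im z))"
    unfolding theta11_term_def norm_mult norm_of_real norm_exp_eq_Re
    by (intro mult_mono) (auto simp: q_def mult.assoc)
  also have "exp (- (2 * pi * ((norm \<gamma>)\<^sup>2 + (norm \<delta>)\<^sup>2) * Im z)) =
      exp (- (2 * pi * Im z) * (norm \<gamma>)\<^sup>2) * exp (- (2 * pi * Im z) * (norm \<delta>)\<^sup>2)"
    unfolding exp_add[symmetric] by (rule arg_cong[of _ _ exp]) (simp add: algebra_simps)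
  finally show ?thesis by (simp add: q_def mult_ac)
qed

lemma theta11_abs_summable:
  fixes L :: "(real^'n) set"
  assumes "is_lattice L" "Im z > 0"
  shows "(\<lambda>(\<gamma>, \<delta>). norm (theta11_term z \<gamma> \<delta>)) summable_on L \<times> L"
proof -
  define f where "f v = (norm v)\<^sup>2 * exp (- (2 * pi * Im z) * (norm v)\<^sup>2)" for v :: "real^'n"
  have f: "f summable_on L"
    unfolding f_def by (rule lattice_gaussian_summable) (use assms in auto)
  have "(\<lambda>(x, y). f x * f y) summable_on L \<times> L"
  proof (rule summable_on_SigmaI)
    show "((\<lambda>y. case (x, y) of (x, y) \<Rightarrow> f x * f y) has_sum f x * infsum f L) L" for x
      using has_sum_cmult_right[OF has_sum_infsum[OF f], of "f x"] by simp
    show "(\<lambda>x. f x * infsum f L) summable_on L"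
      by (rule summable_on_cmult_left[OF f])
  qed (auto simp: f_def)
  then show ?thesis
    by (rule summable_on_comparison_test) (use norm_theta11_term_le in \<open>auto simp: f_def\<close>)
qed

end

theory Submission
  imports Defs
begin

text \<open>
  Sum over \<open>\<delta>\<close> first. The inner sum over \<open>\<delta>\<close> involves the quadratic form
  \<open>Q(x) = \<Sum>\<^sub>\<delta> w(\<delta>) \<langle>x, \<delta>\<rangle>\<^sup>2\<close>, whose weight \<open>w(\<delta>) = exp(2 \<pi> i \<parallel>\<delta>\<parallel>\<^sup>2 z)\<close> depends only on the
  length of \<open>\<delta>\<close>. Reindexing the sum by an orthogonal automorphism of the lattice shows that \<open>Q\<close> is
  invariant, so by a real version of Schur's lemma (\<open>invariant_form_is_scalar\<close>, applied to real and
  imaginary parts) \<open>Q(x) = c \<parallel>x\<parallel>\<^sup>2\<close>. Summing over an orthonormal basis gives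
  \<open>n c = \<Sum>\<^sub>\<delta> w(\<delta>) \<parallel>\<delta>\<parallel>\<^sup>2\<close>; in other words, \<open>L\<close> weighted by \<open>w\<close> behaves like a spherical
  2-design (\<open>radial_second_moment\<close>). Hence
  \<open>1/2 Q(\<gamma>) - 1/(2n) \<parallel>\<gamma>\<parallel>\<^sup>2 \<Sum>\<^sub>\<delta> w(\<delta>) \<parallel>\<delta>\<parallel>\<^sup>2 = 0\<close> for every single \<open>\<gamma>\<close>, and absolute
  convergence allows the double series to be computed as an iterated one.
\<close>

text \<open>
  The kernel of a positive semidefinite form contains all its isotropic vectors: along each line
  through such a vector the form attains its minimum \<open>0\<close> there, so its derivative vanishes.
\<close>

lemma psd_isotropic_imp_kernel:
  fixes p :: "'a::real_vector \<Rightarrow> 'a \<Rightarrow> real"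
  assumes bl: "bilinear p" and sym: "\<And>x y. p x y = p y x"
    and psd: "\<And>x. p x x \<ge> 0" and iso: "p x x = 0"
  shows "p x y = 0"
proof -
  define a d where "a = p x y" and "d = p y y"
  have d: "d \<ge> 0" using psd by (simp add: d_def)
  have pos: "0 \<le> 2 * t * a + t\<^sup>2 * d" for t
  proof -
    have "p (x + t *\<^sub>R y) (x + t *\<^sub>R y) = 2 * t * a + t\<^sup>2 * d"
      using iso sym[of y x]
      by (simp add: a_def d_def bilinear_ladd[OF bl] bilinear_radd[OF bl] bilinear_lmul[OF bl]
          bilinear_rmul[OF bl] power2_eq_square algebra_simps)
    then show ?thesis using psd by metis
  qed
  \<comment> \<open>Near the minimiser of the polynomial in \<open>t\<close>; the \<open>+ 1\<close> avoids dividing by \<open>d = 0\<close>.\<close>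
  define t where "t = - a / (d + 1)"
  have a: "a = - t * (d + 1)" using d by (simp add: t_def)
  have "2 * t * a + t\<^sup>2 * d = - (t\<^sup>2 * (d + 2))"
    by (subst a) (simp add: power2_eq_square algebra_simps)
  then have "t\<^sup>2 * (d + 2) \<le> 0" using pos[of t] by linarith
  then have "t = 0" using d by (simp add: mult_le_0_iff)
  then show ?thesis using a by (simp add: a_def)
qed

text \<open>
  Over the reals a commuting operator need not be scalar, but a self-adjoint one is, since it has
  a real eigenvalue. The eigenvalue is the maximum \<open>c\<close> of \<open>b x x\<close> on the unit sphere; its eigenspace
  is the kernel of the semidefinite form \<open>c \<langle>x, y\<rangle> - b x y\<close>, which is nonzero and invariant, hence
  everything.
\<close>

lemma invariant_form_is_scalar:
  fixes b :: "'a::euclidean_space \<Rightarrow> 'a \<Rightarrow> real"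
  assumes irr: "acts_irreducibly G"
    and orth: "\<And>g. g \<in> G \<Longrightarrow> orthogonal_transformation g"
    and bl: "bilinear b" and sym: "\<And>x y. b x y = b y x"
    and inv: "\<And>g x y. g \<in> G \<Longrightarrow> b (g x) (g y) = b x y"
  obtains c where "\<And>x y. b x y = c * (x \<bullet> y)"
proof -
  have "bounded_bilinear b"
    using bl by (simp add: bilinear_conv_bounded_bilinear)
  then have cont: "continuous_on (sphere 0 1) (\<lambda>x. b x x)"
    by (rule bounded_bilinear.continuous_on[OF _ continuous_on_id continuous_on_id])
  obtain x0 where "x0 \<in> sphere 0 1" "\<forall>y\<in>sphere 0 1. b y y \<le> b x0 x0"
    using continuous_attains_sup[OF compact_sphere _ cont] by auto
  then have x0: "norm x0 = 1" and max: "\<And>y. norm y = 1 \<Longrightarrow> b y y \<le> b x0 x0"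
    by auto
  define c where "c = b x0 x0"
  define p where "p x y = c * (x \<bullet> y) - b x y" for x y
  have p: "bilinear p"
    unfolding bilinear_def p_def
    by (auto intro!: linearI simp: bilinear_ladd[OF bl] bilinear_radd[OF bl] bilinear_lmul[OF bl]
        bilinear_rmul[OF bl] algebra_simps)
  have psym: "p x y = p y x" for x y
    unfolding p_def by (simp only: inner_commute[of x y] sym[of x y])
  have psd: "p y y \<ge> 0" for y
  proof (cases "y = 0")
    case True
    then show ?thesis using bilinear_lzero[OF p] by simp
  next
    case False
    have "b y y = (norm y)\<^sup>2 * b (sgn y) (sgn y)"
      using False
      by (simp add: sgn_div_norm bilinear_lmul[OF bl] bilinear_rmul[OF bl] power2_eq_square divide_simps)
    also have "\<dots> \<le> (norm y)\<^sup>2 * c"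
      unfolding c_def using False by (intro mult_left_mono max) (auto simp: norm_sgn)
    finally show ?thesis by (simp add: p_def power2_norm_eq_inner mult.commute)
  qed
  define W where "W = {x. \<forall>y. p x y = 0}"
  have sub: "subspace W"
    by (rule subspaceI)
      (auto simp: W_def bilinear_lzero[OF p] bilinear_ladd[OF p] bilinear_lmul[OF p])
  have "p x0 x0 = 0"
    using x0 by (simp add: p_def c_def norm_eq_1)
  then have "x0 \<in> W"
    unfolding W_def using psd_isotropic_imp_kernel[OF p psym psd] by blast
  then have ne: "W \<noteq> {0}" using x0 by auto
  have "g ` W \<subseteq> W" if g: "g \<in> G" for g
  proof -
    have "p (g x) y = 0" if "x \<in> W" for x y
    proof -
      obtain y' where "y = g y'"
        using orthogonal_transformation_surj[OF orth[OF g]] by (metis surjD)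
      then show ?thesis
        using that inv[OF g] orth[OF g] by (simp add: W_def p_def orthogonal_transformation_def)
    qed
    then show ?thesis by (auto simp: W_def)
  qed
  then have "W = UNIV"
    using irr sub ne unfolding acts_irreducibly_def by blast
  then have "b x y = c * (x \<bullet> y)" for x y
    by (auto simp: W_def p_def set_eq_iff)
  then show ?thesis by (rule that)
qed

lemma has_sum_sum:
  fixes f :: "'i \<Rightarrow> 'a \<Rightarrow> 'b::topological_comm_monoid_add"
  assumes "\<And>i. i \<in> I \<Longrightarrow> (f i has_sum s i) A"
  shows "((\<lambda>x. \<Sum>i\<in>I. f i x) has_sum (\<Sum>i\<in>I. s i)) A"
  using assms by (induction I rule: infinite_finite_induct) (auto intro: has_sum_add)

text \<open>
  Each orthogonal symmetry of \<open>L\<close> permutes \<open>L\<close> and preserves the radial weight, so reindexing by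
  it shows that the form \<open>\<Sum>\<^sub>v w(\<parallel>v\<parallel>) \<langle>x, v\<rangle> \<langle>y, v\<rangle>\<close> is invariant, hence \<open>c \<langle>x, y\<rangle>\<close>. The value of
  \<open>c\<close> comes from taking the trace.
\<close>

lemma radial_second_moment_real:
  fixes L :: "(real^'n) set" and w :: "real \<Rightarrow> real"
  assumes irr: "acts_irreducibly (orthogonal_group_of L)"
    and summ: "(\<lambda>v. \<bar>w (norm v)\<bar> * (norm v)\<^sup>2) summable_on L"
  shows "(\<Sum>\<^sub>\<infinity>v\<in>L. w (norm v) * (x \<bullet> v)\<^sup>2) =
    (norm x)\<^sup>2 / real CARD('n) * (\<Sum>\<^sub>\<infinity>v\<in>L. w (norm v) * (norm v)\<^sup>2)"
proof -
  define t where "t x y v = w (norm v) * ((x \<bullet> v) * (y \<bullet> v))" for x y v :: "real^'n"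
  define b where "b x y = infsum (t x y) L" for x y
  have t: "t x y summable_on L" for x y
  proof (rule abs_summable_summable, rule summable_on_comparison_test)
    show "(\<lambda>v. norm x * norm y * (\<bar>w (norm v)\<bar> * (norm v)\<^sup>2)) summable_on L"
      by (rule summable_on_cmult_right[OF summ])
    show "norm (t x y v) \<le> norm x * norm y * (\<bar>w (norm v)\<bar> * (norm v)\<^sup>2)" for v
    proof -
      have "\<bar>x \<bullet> v\<bar> * \<bar>y \<bullet> v\<bar> \<le> (norm x * norm v) * (norm y * norm v)"
        by (intro mult_mono Cauchy_Schwarz_ineq2) auto
      then have "\<bar>w (norm v)\<bar> * (\<bar>x \<bullet> v\<bar> * \<bar>y \<bullet> v\<bar>)
          \<le> \<bar>w (norm v)\<bar> * ((norm x * norm v) * (norm y * norm v))"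
        by (intro mult_left_mono) auto
      then show ?thesis
        by (simp add: t_def abs_mult power2_eq_square mult_ac)
    qed
  qed simp
  have sym: "b x y = b y x" for x y
    unfolding b_def t_def by (simp only: mult.commute[of "x \<bullet> _"])
  have add: "b (x + y) z = b x z + b y z" for x y z
  proof -
    have "t (x + y) z = (\<lambda>v. t x z v + t y z v)"
      by (simp add: t_def inner_add_left algebra_simps fun_eq_iff)
    then show ?thesis by (simp add: b_def infsum_add t)
  qed
  have scale: "b (a *\<^sub>R x) z = a *\<^sub>R b x z" for a x z
  proof -
    have "t (a *\<^sub>R x) z = (\<lambda>v. a * t x z v)"
      by (simp add: t_def algebra_simps fun_eq_iff)
    then show ?thesis by (simp add: b_def infsum_cmult_right t)
  qed
  have "linear (\<lambda>x. b x z)" for z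
    by (rule linearI) (use add scale in auto)
  moreover have "b z = (\<lambda>x. b x z)" for z
    using sym by blast
  ultimately have bl: "bilinear b"
    unfolding bilinear_def by metis
  have inv: "b (g x) (g y) = b x y" if "g \<in> orthogonal_group_of L" for g x y
  proof -
    have g: "orthogonal_transformation g" "g ` L = L"
      using that by (auto simp: orthogonal_group_of_def)
    have "inj_on g L"
      using orthogonal_transformation_inj[OF g(1)] by (rule inj_on_subset) simp
    then have "infsum (t (g x) (g y)) (g ` L) = infsum (t (g x) (g y) \<circ> g) L"
      by (rule infsum_reindex)
    also have "t (g x) (g y) \<circ> g = t x y"
      using g(1) by (simp add: fun_eq_iff t_def orthogonal_transformation_norm
          orthogonal_transformation_def[of g])
    finally show ?thesis by (simp add: b_def g(2))
  qed
  obtain c where c: "\<And>x y. b x y = c * (x \<bullet> y)"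
    using invariant_form_is_scalar[OF irr _ bl sym inv]
    by (auto simp: orthogonal_group_of_def)
  have "real CARD('n) * c = (\<Sum>e\<in>Basis. b e e)"
    by (simp add: c inner_same_Basis)
  also have "\<dots> = (\<Sum>\<^sub>\<infinity>v\<in>L. \<Sum>e\<in>Basis. t e e v)"
    unfolding b_def by (rule infsumI[symmetric], rule has_sum_sum, rule has_sum_infsum, rule t)
  also have "(\<lambda>v. \<Sum>e\<in>Basis. t e e v) = (\<lambda>v. w (norm v) * (norm v)\<^sup>2)"
    unfolding fun_eq_iff t_def sum_distrib_left[symmetric] power2_norm_eq_inner
    by (subst euclidean_inner) (simp add: inner_commute)
  finally have "c = (\<Sum>\<^sub>\<infinity>v\<in>L. w (norm v) * (norm v)\<^sup>2) / real CARD('n)"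
    by (simp add: field_simps)
  moreover have "(\<Sum>\<^sub>\<infinity>v\<in>L. w (norm v) * (x \<bullet> v)\<^sup>2) = b x x"
    by (simp add: b_def t_def[abs_def] power2_eq_square)
  ultimately show ?thesis
    by (simp add: c power2_norm_eq_inner)
qed

text \<open>
  The invariant form attached to a complex weight is complex-valued, so Schur's lemma in its real
  version applies to its real and imaginary parts separately.
\<close>

lemma radial_second_moment:
  fixes L :: "(real^'n) set" and w :: "real \<Rightarrow> complex"
  assumes irr: "acts_irreducibly (orthogonal_group_of L)"
    and summ: "(\<lambda>v. norm (w (norm v)) * (norm v)\<^sup>2) summable_on L"
  shows "((\<lambda>v. w (norm v) * of_real ((x \<bullet> v)\<^sup>2 - (norm x)\<^sup>2 / real CARD('n) * (norm v)\<^sup>2))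
    has_sum 0) L"
proof -
  define q where "q v = (x \<bullet> v)\<^sup>2 - (norm x)\<^sup>2 / real CARD('n) * (norm v)\<^sup>2" for v
  have real: "((\<lambda>v. u (norm v) * q v) has_sum 0) L"
    if le: "\<And>s. \<bar>u s\<bar> \<le> norm (w s)" for u :: "real \<Rightarrow> real"
  proof -
    have abs: "(\<lambda>v. \<bar>u (norm v)\<bar> * (norm v)\<^sup>2) summable_on L"
      by (rule summable_on_comparison_test[OF summ]) (auto intro!: mult_right_mono le)
    have s1: "(\<lambda>v. u (norm v) * (norm v)\<^sup>2) summable_on L"
      by (rule abs_summable_summable) (use abs in \<open>simp add: abs_mult\<close>)
    have s2: "(\<lambda>v. u (norm v) * (x \<bullet> v)\<^sup>2) summable_on L"
    proof (rule abs_summable_summable, rule summable_on_comparison_test)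
      show "(\<lambda>v. (norm x)\<^sup>2 * (\<bar>u (norm v)\<bar> * (norm v)\<^sup>2)) summable_on L"
        by (rule summable_on_cmult_right[OF abs])
      show "norm (u (norm v) * (x \<bullet> v)\<^sup>2) \<le> (norm x)\<^sup>2 * (\<bar>u (norm v)\<bar> * (norm v)\<^sup>2)" for v
        using mult_left_mono[OF Cauchy_Schwarz_ineq[of x v], of "\<bar>u (norm v)\<bar>"]
        by (simp add: abs_mult power2_norm_eq_inner mult_ac)
    qed simp
    have "((\<lambda>v. u (norm v) * (x \<bullet> v)\<^sup>2
          + - ((norm x)\<^sup>2 / real CARD('n)) * (u (norm v) * (norm v)\<^sup>2)) has_sum
        ((\<Sum>\<^sub>\<infinity>v\<in>L. u (norm v) * (x \<bullet> v)\<^sup>2)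
          + - ((norm x)\<^sup>2 / real CARD('n)) * (\<Sum>\<^sub>\<infinity>v\<in>L. u (norm v) * (norm v)\<^sup>2))) L"
      by (intro has_sum_add has_sum_cmult_right has_sum_infsum s1 s2)
    then show ?thesis
      by (simp add: radial_second_moment_real[OF irr abs] q_def algebra_simps)
  qed
  have "((\<lambda>v. complex_of_real (Re (w (norm v)) * q v)
      + \<i> * complex_of_real (Im (w (norm v)) * q v)) has_sum
      (complex_of_real 0 + \<i> * complex_of_real 0)) L"
    by (intro has_sum_add has_sum_cmult_right has_sum_of_real real abs_Re_le_cmod abs_Im_le_cmod)
  moreover have "complex_of_real (Re (w s) * r) + \<i> * complex_of_real (Im (w s) * r)
      = w s * of_real r" for s r
    by (simp add: complex_eq_iff)
  ultimately show ?thesis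
    by (simp only: q_def) simp
qed

theorem proposition3p5:
  fixes L :: "(real^'n) set"
  assumes "is_lattice L"
    and "acts_irreducibly (orthogonal_group_of L)"
  shows "\<forall>z. Im z > 0 \<longrightarrow> theta11 L z = 0"
proof (intro allI impI)
  fix z :: complex
  assume z: "Im z > 0"
  define w where "w s = exp (2 * of_real pi * \<i> * of_real (s\<^sup>2) * z)" for s :: real
  have "norm (w s) = exp (- (2 * pi * Im z) * s\<^sup>2)" for s
    by (simp add: w_def norm_exp_eq_Re mult_ac)
  then have summ: "(\<lambda>v. norm (w (norm v)) * (norm v)\<^sup>2) summable_on L"
    using lattice_gaussian_summable[OF assms(1), of "2 * pi * Im z"] z by (simp add: mult_ac)
  have inner: "(\<Sum>\<^sub>\<infinity>\<delta>\<in>L. theta11_term z \<gamma> \<delta>) = 0" for \<gamma>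
  proof -
    have "theta11_term z \<gamma> \<delta> = (w (norm \<gamma>) / 2) * (w (norm \<delta>) *
        of_real ((\<gamma> \<bullet> \<delta>)\<^sup>2 - (norm \<gamma>)\<^sup>2 / real CARD('n) * (norm \<delta>)\<^sup>2))" for \<delta>
    proof -
      have "exp (2 * of_real pi * \<i> * of_real ((norm \<gamma>)\<^sup>2 + (norm \<delta>)\<^sup>2) * z)
          = w (norm \<gamma>) * w (norm \<delta>)"
        by (simp add: w_def exp_add[symmetric] algebra_simps)
      then show ?thesis
        by (simp only: theta11_term_def) (simp add: field_simps)
    qed
    then have "(theta11_term z \<gamma> has_sum (w (norm \<gamma>) / 2) * 0) L"
      using has_sum_cmult_right[OF radial_second_moment[OF assms(2) summ]] by presburger
    then show ?thesis by (simp add: infsumI)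
  qed
  have "(\<lambda>(\<gamma>, \<delta>). theta11_term z \<gamma> \<delta>) summable_on L \<times> L"
    by (rule abs_summable_summable)
      (use theta11_abs_summable[OF assms(1) z] in \<open>simp add: case_prod_unfold\<close>)
  then have "theta11 L z = (\<Sum>\<^sub>\<infinity>\<gamma>\<in>L. \<Sum>\<^sub>\<infinity>\<delta>\<in>L. theta11_term z \<gamma> \<delta>)"
    unfolding theta11_def by (rule infsum_Sigma'_banach[symmetric])
  then show "theta11 L z = 0"
    by (simp add: inner)
qed

end
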